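(* Let $F:\mathbb{R}\to\mathbb{R}$ and $\varepsilon_1,\varepsilon_2:\mathbb{R}^2\to\mathbb{R}$ be smooth functions such that the near-identity map $T:(x,y)\mapsto\bigl(x+\varepsilon_1(x,y),\,y+\varepsilon_2(x,y)\bigr)$ is a diffeomorphism of $\mathbb{R}^2$. Let $$h_1=h:(x,y)\mapsto(y,x),\qquad h_2:(x,y)\mapsto(-x+F(y),\,y),\qquad \tilde h_2=T^{-1}\circ h_2\circ T .$$ Then the map $\hat H:(x,y)\mapsto(\bar x,\bar y)$ given by $$\bar x=y+\varepsilon_2(x,y)-\varepsilon_2(\bar y,\bar x),\qquad \bar y=-x+F\bigl(y+\varepsilon_2(x,y)\bigr)-\varepsilon_1(x,y)-\varepsilon_1(\bar y,\bar x)$$ is the composition $\hat H=h_1\circ\tilde h_2$, and it is a reversible perturbation of the conservative Hénon-like map $H:\ \bar x=y,\ \bar y=-x+F(y)$; that is, $\hat H$ is reversible with respect to $h$ and coincides with $H$ when $\varepsilon_1\equiv\varepsilon_2\equiv0$.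
   Context: A diffeomorphism $f$ is reversible with respect to an involution $h$ ($h^2=\mathrm{Id}$) if $f=h\circ f^{-1}\circ h$. The maps $h_1,h_2$ are involutions with $H=h_1\circ h_2$. "Near-identity" only expresses that $\varepsilon_1,\varepsilon_2$ are thought of as small perturbing functions. The assertion that the displayed implicit formulas give $\hat H=h_1\circ\tilde h_2$ means that $(\bar x,\bar y)=(h_1\circ\tilde h_2)(x,y)$ if and only if the two displayed relations hold. *)

theory Defs
  imports "HOL-Analysis.Analysis"
begin

text \<open>
  Coordinate-free \<open>C\<^sup>k\<close>: being \<open>C\<^sup>0\<close> is continuity, and \<open>f\<close> is \<open>C\<^bsup>k+1\<^esup>\<close> if it is differentiable
  everywhere and each directional derivative \<open>\<lambda>x. Df(x) v\<close> is \<open>C\<^sup>k\<close>.  Since the space is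
  finite-dimensional, this agrees with continuity of all partial derivatives of order at most \<open>k\<close>.
\<close>

primrec C_k :: "nat \<Rightarrow> ('a::euclidean_space \<Rightarrow> 'b::real_normed_vector) \<Rightarrow> bool" where
  "C_k 0 f \<longleftrightarrow> continuous_on UNIV f"
| "C_k (Suc k) f \<longleftrightarrow>
     (\<forall>x. f differentiable (at x)) \<and> (\<forall>v. C_k k (\<lambda>x. frechet_derivative f (at x) v))"

definition smooth :: "('a::euclidean_space \<Rightarrow> 'b::real_normed_vector) \<Rightarrow> bool" where
  "smooth f \<longleftrightarrow> (\<forall>k. C_k k f)"

definition diffeomorphism :: "('a::euclidean_space \<Rightarrow> 'a) \<Rightarrow> bool" where
  "diffeomorphism f \<longleftrightarrow> bij f \<and> smooth f \<and> smooth (inv f)"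

definition involution :: "('a \<Rightarrow> 'a) \<Rightarrow> bool" where
  "involution h \<longleftrightarrow> h \<circ> h = id"

definition reversible_wrt :: "('a::euclidean_space \<Rightarrow> 'a) \<Rightarrow> ('a \<Rightarrow> 'a) \<Rightarrow> bool" where
  "reversible_wrt f h \<longleftrightarrow> diffeomorphism f \<and> involution h \<and> f = h \<circ> inv f \<circ> h"

definition h1 :: "real \<times> real \<Rightarrow> real \<times> real" where
  "h1 = (\<lambda>(x, y). (y, x))"

definition h2 :: "(real \<Rightarrow> real) \<Rightarrow> real \<times> real \<Rightarrow> real \<times> real" where
  "h2 F = (\<lambda>(x, y). (- x + F y, y))"

definition near_id ::
  "(real \<times> real \<Rightarrow> real) \<Rightarrow> (real \<times> real \<Rightarrow> real) \<Rightarrow> real \<times> real \<Rightarrow> real \<times> real" where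
  "near_id \<epsilon>1 \<epsilon>2 = (\<lambda>(x, y). (x + \<epsilon>1 (x, y), y + \<epsilon>2 (x, y)))"

definition h2_tilde ::
  "(real \<Rightarrow> real) \<Rightarrow> (real \<times> real \<Rightarrow> real) \<Rightarrow> (real \<times> real \<Rightarrow> real) \<Rightarrow> real \<times> real \<Rightarrow> real \<times> real"
where
  "h2_tilde F \<epsilon>1 \<epsilon>2 = inv (near_id \<epsilon>1 \<epsilon>2) \<circ> h2 F \<circ> near_id \<epsilon>1 \<epsilon>2"

definition henon :: "(real \<Rightarrow> real) \<Rightarrow> real \<times> real \<Rightarrow> real \<times> real" where
  "henon F = (\<lambda>(x, y). (y, - x + F y))"

end

theory Submission
  imports Defs
begin

text \<open>
  Write \<open>T\<close> for the near-identity map.  Applying \<open>h\<^sub>1\<close> and then \<open>T\<close> to both sides of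
  \<open>(x', y') = H_hat (x, y)\<close> turns it into \<open>T (y', x') = h\<^sub>2 (T (x, y))\<close>, in which no inverse occurs;
  its two components are the displayed implicit relations.

  Reversibility does not depend on the formulas.  The map \<open>h\<^sub>2\<close> is an involution, hence so is its
  conjugate \<open>T\<^sup>-\<^sup>1 \<circ> h\<^sub>2 \<circ> T\<close>, and a product \<open>h \<circ> g\<close> of two involutions has inverse \<open>g \<circ> h\<close>,
  which is its conjugate by \<open>h\<close> (lemma \<open>reversible_comp_involutions\<close>).  What costs work is that
  this product is a diffeomorphism.  A smooth involution is its own inverse and thus a
  diffeomorphism, so everything reduces to the closure of \<open>C\<^sup>k\<close> maps under composition
  (\<open>C_k_compose\<close>), which is proved here by induction on \<open>k\<close> from the chain and product rules.
\<close>

section \<open>Calculus of \<open>C\<^sup>k\<close> maps\<close>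

lemma C_k_SucI:
  assumes "\<And>x. (f has_derivative f' x) (at x)" and "\<And>v. C_k k (\<lambda>x. f' x v)"
  shows "C_k (Suc k) f"
proof -
  have "frechet_derivative f (at x) = f' x" for x
    using frechet_derivative_at[OF assms(1)] by simp
  then show ?thesis
    using assms by (auto simp: differentiable_def)
qed

lemma C_k_Suc_has_derivative:
  assumes "C_k (Suc k) f"
  shows "(f has_derivative frechet_derivative f (at x)) (at x)"
  using assms by (simp add: frechet_derivative_works[symmetric])

lemma C_k_Suc_imp_C_k: "C_k (Suc k) f \<Longrightarrow> C_k k f"
proof (induction k arbitrary: f)
  case 0
  then show ?case
    by (auto intro!: continuous_at_imp_continuous_on differentiable_imp_continuous_within)
next
  case (Suc k)
  have "C_k k (\<lambda>x. frechet_derivative f (at x) v)" for v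
    using Suc.prems by (intro Suc.IH) (simp only: C_k.simps(2)[of "Suc k" f])
  with Suc.prems show ?case
    by simp
qed

lemma C_k_const: "C_k k (\<lambda>x. c)"
proof (induction k arbitrary: c)
  case (Suc k)
  show ?case
    by (rule C_k_SucI[OF has_derivative_const Suc])
qed simp

lemma C_k_bounded_linear:
  assumes "bounded_linear L"
  shows "C_k k L"
proof (cases k)
  case 0
  then show ?thesis
    using assms by (simp add: linear_continuous_on)
next
  case (Suc j)
  then show ?thesis
    using C_k_SucI[OF bounded_linear_imp_has_derivative[OF assms] C_k_const] by simp
qed

lemma C_k_add:
  "C_k k f \<Longrightarrow> C_k k g \<Longrightarrow> C_k k (\<lambda>x. f x + g x)"
proof (induction k arbitrary: f g)
  case 0
  then show ?case
    by (simp add: continuous_on_add)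
next
  case (Suc k)
  show ?case
    by (rule C_k_SucI[OF has_derivative_add[OF Suc.prems[THEN C_k_Suc_has_derivative]]])
      (use Suc in simp)
qed

lemma C_k_sum:
  assumes "\<And>i. i \<in> I \<Longrightarrow> C_k k (f i)"
  shows "C_k k (\<lambda>x. \<Sum>i\<in>I. f i x)"
  using assms
  by (induction I rule: infinite_finite_induct) (auto simp: C_k_const C_k_add)

lemma C_k_bounded_linear_compose:
  assumes L: "bounded_linear L"
  shows "C_k k f \<Longrightarrow> C_k k (\<lambda>x. L (f x))"
proof (induction k arbitrary: f)
  case 0
  then show ?case
    using L by (simp add: bounded_linear.continuous_on)
next
  case (Suc k)
  show ?case
    by (rule C_k_SucI[OF bounded_linear.has_derivative[OF L C_k_Suc_has_derivative[OF Suc.prems]]])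
      (use Suc in simp)
qed

text \<open>
  The product rule expresses the derivative by products in which one factor is undifferentiated;
  that factor is known to be \<open>C\<^bsup>k+1\<^esup>\<close> and enters the induction hypothesis as a \<open>C\<^sup>k\<close> map.
\<close>

lemma C_k_scaleR:
  "C_k k f \<Longrightarrow> C_k k g \<Longrightarrow> C_k k (\<lambda>x. f x *\<^sub>R g x)"
proof (induction k arbitrary: f g)
  case 0
  then show ?case
    by (simp add: continuous_on_scaleR)
next
  case (Suc k)
  have "((\<lambda>x. f x *\<^sub>R g x) has_derivative
      (\<lambda>v. f x *\<^sub>R frechet_derivative g (at x) v + frechet_derivative f (at x) v *\<^sub>R g x)) (at x)" for x
    using Suc.prems by (intro has_derivative_scaleR C_k_Suc_has_derivative)
  moreover have "C_k k (\<lambda>x. f x *\<^sub>R frechet_derivative g (at x) v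
      + frechet_derivative f (at x) v *\<^sub>R g x)" for v
    using Suc.prems Suc.prems[THEN C_k_Suc_imp_C_k] by (intro C_k_add Suc.IH) simp_all
  ultimately show ?case
    by (rule C_k_SucI)
qed

text \<open>
  The chain rule gives \<open>x \<mapsto> Dg(f x) (Df(x) v)\<close>, which is not of the form \<open>G (f x)\<close>, because
  the direction moves with \<open>x\<close>.  Expanding the direction in an orthonormal basis separates the
  two dependencies: the derivative becomes a sum of products of coordinates of \<open>Df(x) v\<close>
  with \<open>Dg(f x) b\<close> for fixed \<open>b\<close>, and the latter are compositions with \<open>f\<close> of \<open>C\<^sup>k\<close> maps.
\<close>

lemma C_k_compose:
  fixes f :: "'a::euclidean_space \<Rightarrow> 'b::euclidean_space"
    and g :: "'b \<Rightarrow> 'c::real_normed_vector"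
  shows "C_k k g \<Longrightarrow> C_k k f \<Longrightarrow> C_k k (\<lambda>x. g (f x))"
proof (induction k arbitrary: g)
  case 0
  then show ?case
    by (auto intro: continuous_on_compose2)
next
  case (Suc k)
  let ?Df = "\<lambda>x. frechet_derivative f (at x)"
  let ?Dg = "\<lambda>y. frechet_derivative g (at y)"
  have deriv: "((\<lambda>x. g (f x)) has_derivative (\<lambda>v. ?Dg (f x) (?Df x v))) (at x)" for x
    using diff_chain_at[OF C_k_Suc_has_derivative[OF Suc.prems(2)]
        C_k_Suc_has_derivative[OF Suc.prems(1)]]
    by (simp add: o_def)
  have "C_k k (\<lambda>x. ?Dg (f x) (?Df x v))" for v
  proof -
    have "?Dg (f x) (?Df x v) = (\<Sum>b\<in>Basis. (?Df x v \<bullet> b) *\<^sub>R ?Dg (f x) b)" for x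
    proof -
      have lin: "linear (?Dg (f x))"
        using C_k_Suc_has_derivative[OF Suc.prems(1)] by (rule has_derivative_linear)
      have "?Dg (f x) (\<Sum>b\<in>Basis. (?Df x v \<bullet> b) *\<^sub>R b)
          = (\<Sum>b\<in>Basis. (?Df x v \<bullet> b) *\<^sub>R ?Dg (f x) b)"
        by (simp add: linear_sum[OF lin] linear_scale[OF lin])
      then show ?thesis
        by (simp only: euclidean_representation)
    qed
    moreover have "C_k k (\<lambda>x. \<Sum>b\<in>Basis. (?Df x v \<bullet> b) *\<^sub>R ?Dg (f x) b)"
    proof (intro C_k_sum C_k_scaleR)
      show "C_k k (\<lambda>x. ?Df x v \<bullet> b)" for b
        using Suc.prems(2) by (intro C_k_bounded_linear_compose[OF bounded_linear_inner_left]) simp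
      show "C_k k (\<lambda>x. ?Dg (f x) b)" for b
        using Suc.prems by (intro Suc.IH C_k_Suc_imp_C_k[OF Suc.prems(2)]) simp
    qed
    ultimately show ?thesis
      by simp
  qed
  with deriv show ?case
    by (rule C_k_SucI)
qed

section \<open>Smooth involutions and reversibility\<close>

lemma smooth_compose: "smooth g \<Longrightarrow> smooth f \<Longrightarrow> smooth (g \<circ> f)"
  by (simp add: smooth_def o_def C_k_compose)

lemma diffeomorphism_compose:
  "diffeomorphism g \<Longrightarrow> diffeomorphism f \<Longrightarrow> diffeomorphism (g \<circ> f)"
  by (simp add: diffeomorphism_def bij_comp o_inv_distrib smooth_compose)

lemma diffeomorphism_inv: "diffeomorphism f \<Longrightarrow> diffeomorphism (inv f)"
  by (simp add: diffeomorphism_def bij_imp_bij_inv inv_inv_eq)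

lemma diffeomorphism_smooth_involution:
  assumes "involution h" "smooth h"
  shows "diffeomorphism h"
proof -
  have "h \<circ> h = id"
    using assms(1) by (simp add: involution_def)
  then have "bij h" "inv h = h"
    by (auto intro: o_bij inv_unique_comp)
  with assms(2) show ?thesis
    by (simp add: diffeomorphism_def)
qed

lemma involution_conjugate:
  assumes "bij t" "involution g"
  shows "involution (inv t \<circ> g \<circ> t)"
  using assms
  by (simp add: involution_def fun_eq_iff bij_is_inj bij_is_surj surj_f_inv_f)

lemma reversible_comp_involutions:
  assumes "involution h" "involution g" "diffeomorphism h" "diffeomorphism g"
  shows "reversible_wrt (h \<circ> g) h"
proof -
  have hh: "h (h p) = p" and gg: "g (g p) = p" for p
    using assms(1,2) by (simp_all add: involution_def fun_eq_iff)
  have "inv (h \<circ> g) = g \<circ> h"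
    by (rule inv_unique_comp) (simp_all add: fun_eq_iff hh gg)
  then have "h \<circ> g = h \<circ> inv (h \<circ> g) \<circ> h"
    by (simp add: fun_eq_iff hh)
  with assms show ?thesis
    by (simp add: reversible_wrt_def diffeomorphism_compose)
qed

section \<open>The two involutions of the Henon-like map\<close>

lemma involution_h1: "involution h1"
  by (simp add: involution_def h1_def fun_eq_iff)

lemma diffeomorphism_h1: "diffeomorphism h1"
proof (rule diffeomorphism_smooth_involution[OF involution_h1])
  have "bounded_linear h1"
    unfolding h1_def case_prod_beta
    by (intro bounded_linear_Pair bounded_linear_fst bounded_linear_snd)
  then show "smooth h1"
    by (simp add: smooth_def C_k_bounded_linear)
qed

lemma involution_h2: "involution (h2 F)"
  by (simp add: involution_def h2_def fun_eq_iff)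

text \<open>
  Smoothness comes from splitting \<open>h2 F (x, y)\<close> into the linear map \<open>(- x, y)\<close> and the
  summand \<open>(F y, 0)\<close>, which is \<open>F\<close> between a linear projection and a linear embedding.
\<close>

lemma diffeomorphism_h2:
  assumes "smooth F"
  shows "diffeomorphism (h2 F)"
proof (rule diffeomorphism_smooth_involution[OF involution_h2])
  have linear_part: "bounded_linear (\<lambda>p::real \<times> real. (- fst p, snd p))"
    by (intro bounded_linear_Pair bounded_linear_minus bounded_linear_fst bounded_linear_snd)
  have embed: "bounded_linear (\<lambda>t::real. (t, 0::real))"
    by (intro bounded_linear_Pair bounded_linear_ident bounded_linear_zero)
  have "C_k k (\<lambda>p::real \<times> real. F (snd p))" for k
    using assms by (simp add: smooth_def C_k_compose C_k_bounded_linear bounded_linear_snd)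
  then have "C_k k (\<lambda>p::real \<times> real. (- fst p, snd p) + (F (snd p), 0))" for k
    by (rule C_k_add[OF C_k_bounded_linear[OF linear_part] C_k_bounded_linear_compose[OF embed]])
  moreover have "h2 F = (\<lambda>p. (- fst p, snd p) + (F (snd p), 0))"
    by (simp add: h2_def fun_eq_iff)
  ultimately show "smooth (h2 F)"
    by (simp add: smooth_def)
qed

theorem lemma6:
  fixes F :: "real \<Rightarrow> real" and \<epsilon>1 \<epsilon>2 :: "real \<times> real \<Rightarrow> real"
  assumes "smooth F" and "smooth \<epsilon>1" and "smooth \<epsilon>2"
    and "diffeomorphism (near_id \<epsilon>1 \<epsilon>2)"
  defines "H_hat \<equiv> h1 \<circ> h2_tilde F \<epsilon>1 \<epsilon>2"
  shows "(\<forall>x y x' y'. (x', y') = H_hat (x, y) \<longleftrightarrow>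
            x' = y + \<epsilon>2 (x, y) - \<epsilon>2 (y', x') \<and>
            y' = - x + F (y + \<epsilon>2 (x, y)) - \<epsilon>1 (x, y) - \<epsilon>1 (y', x')) \<and>
         reversible_wrt H_hat h1 \<and>
         ((\<forall>p. \<epsilon>1 p = 0) \<and> (\<forall>p. \<epsilon>2 p = 0) \<longrightarrow> H_hat = henon F)"
proof (intro conjI allI impI)
  let ?T = "near_id \<epsilon>1 \<epsilon>2"
  have bij_T: "bij ?T"
    using assms(4) by (simp add: diffeomorphism_def)
  show "(x', y') = H_hat (x, y) \<longleftrightarrow>
      x' = y + \<epsilon>2 (x, y) - \<epsilon>2 (y', x') \<and>
      y' = - x + F (y + \<epsilon>2 (x, y)) - \<epsilon>1 (x, y) - \<epsilon>1 (y', x')" for x y x' y'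
  proof -
    have "(x', y') = H_hat (x, y) \<longleftrightarrow> (y', x') = inv ?T (h2 F (?T (x, y)))"
      by (auto simp: H_hat_def h2_tilde_def h1_def split: prod.splits)
    also have "\<dots> \<longleftrightarrow> ?T (y', x') = h2 F (?T (x, y))"
      by (metis bij_T bij_inv_eq_iff)
    also have "\<dots> \<longleftrightarrow> x' = y + \<epsilon>2 (x, y) - \<epsilon>2 (y', x') \<and>
        y' = - x + F (y + \<epsilon>2 (x, y)) - \<epsilon>1 (x, y) - \<epsilon>1 (y', x')"
      by (auto simp: near_id_def h2_def)
    finally show ?thesis .
  qed
  show "reversible_wrt H_hat h1"
    unfolding H_hat_def
  proof (rule reversible_comp_involutions[OF involution_h1 _ diffeomorphism_h1])
    show "involution (h2_tilde F \<epsilon>1 \<epsilon>2)"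
      unfolding h2_tilde_def using bij_T involution_h2 by (rule involution_conjugate)
    show "diffeomorphism (h2_tilde F \<epsilon>1 \<epsilon>2)"
      unfolding h2_tilde_def using assms(1,4)
      by (intro diffeomorphism_compose diffeomorphism_inv diffeomorphism_h2)
  qed
  show "H_hat = henon F" if "(\<forall>p. \<epsilon>1 p = 0) \<and> (\<forall>p. \<epsilon>2 p = 0)"
  proof -
    have "?T = id"
      using that by (simp add: near_id_def fun_eq_iff)
    then have "h2_tilde F \<epsilon>1 \<epsilon>2 = h2 F"
      by (simp add: h2_tilde_def)
    then show ?thesis
      by (simp add: H_hat_def h1_def h2_def henon_def fun_eq_iff)
  qed
qed

end
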